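(* Let $X$ be a compact metric space and $T:X\to X$ continuous, and assume $X$ is zero-dimensional, i.e. for every $\delta>0$ there is a partition of $X$ into closed-open sets each of diameter less than $\delta$. Let $f:X\to\mathbb R$ be continuous. Then for any analytic set $Z\subseteq X$, \[ P_B(T,f,Z)=\sup\{P_B(T,f,K):K\subseteq Z,\ K\text{ compact}\}. \]
   Context: A set is analytic if it is a continuous image of $\mathbb N^{\mathbb N}$ with the product topology. Notation: $d$ metric on $X$; $d_n(x,y)=\max\{d(T^ix,T^iy):0\le i\le n-1\}$, $B_n(x,\epsilon)=\{y:d_n(x,y)<\epsilon\}$, $f_n=\sum_{i=0}^{n-1}f\circ T^i$. Bowen topological pressure: for $\epsilon>0$, $\Gamma=\{B_{n_i}(x_i,\epsilon)\}_i$ (finite or countable) covers $Z$ if $Z\subseteq\bigcup_iB_{n_i}(x_i,\epsilon)$, $n(\Gamma)=\min_in_i$. $M(Z,f,s,N,\epsilon)=\inf_\Gamma\sum_i\exp\big(-sn_i+\sup_{y\in B_{n_i}(x_i,\epsilon)}f_{n_i}(y)\big)$ over covers with $n(\Gamma)\ge N$; $m(Z,f,s,\epsilon)=\lim_NM(Z,f,s,N,\epsilon)$; $P_B(T,f,Z,\epsilon)=\inf\{s:m(Z,f,s,\epsilon)=0\}$; $P_B(T,f,Z)=\lim_{\epsilon\to0}P_B(T,f,Z,\epsilon)$. *)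

theory Defs
  imports "HOL-Analysis.Analysis"
begin

definition bowen_dist :: "('a::metric_space \<Rightarrow> 'a) \<Rightarrow> nat \<Rightarrow> 'a \<Rightarrow> 'a \<Rightarrow> real" where
  "bowen_dist T n x y = Max ((\<lambda>i. dist ((T ^^ i) x) ((T ^^ i) y)) ` {0..<n})"

definition bowen_ball :: "'a::metric_space set \<Rightarrow> ('a \<Rightarrow> 'a) \<Rightarrow> nat \<Rightarrow> 'a \<Rightarrow> real \<Rightarrow> 'a set" where
  "bowen_ball X T n x eps = {y \<in> X. bowen_dist T n x y < eps}"

definition birkhoff_sum :: "('a \<Rightarrow> 'a) \<Rightarrow> ('a \<Rightarrow> real) \<Rightarrow> nat \<Rightarrow> 'a \<Rightarrow> real" where
  "birkhoff_sum T f n y = (\<Sum>i<n. f ((T ^^ i) y))"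

definition bowen_covers :: "'a::metric_space set \<Rightarrow> ('a \<Rightarrow> 'a) \<Rightarrow> 'a set \<Rightarrow> nat \<Rightarrow> real \<Rightarrow> ('a \<times> nat) set set" where
  "bowen_covers X T Z N eps =
     {\<Gamma>. countable \<Gamma> \<and> (\<forall>(x,n)\<in>\<Gamma>. x \<in> X \<and> N \<le> n) \<and>
          Z \<subseteq> (\<Union>(x,n)\<in>\<Gamma>. bowen_ball X T n x eps)}"

definition bowen_M :: "'a::metric_space set \<Rightarrow> ('a \<Rightarrow> 'a) \<Rightarrow> ('a \<Rightarrow> real) \<Rightarrow> 'a set \<Rightarrow> real \<Rightarrow> nat \<Rightarrow> real \<Rightarrow> ennreal" where
  "bowen_M X T f Z s N eps =
     (INF \<Gamma>\<in>bowen_covers X T Z N eps.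
        infsum (\<lambda>(x,n). ennreal (exp (- s * real n
                   + (SUP y\<in>bowen_ball X T n x eps. birkhoff_sum T f n y)))) \<Gamma>)"

definition bowen_m :: "'a::metric_space set \<Rightarrow> ('a \<Rightarrow> 'a) \<Rightarrow> ('a \<Rightarrow> real) \<Rightarrow> 'a set \<Rightarrow> real \<Rightarrow> real \<Rightarrow> ennreal" where
  "bowen_m X T f Z s eps = lim (\<lambda>N. bowen_M X T f Z s N eps)"

definition bowen_pressure_eps :: "'a::metric_space set \<Rightarrow> ('a \<Rightarrow> 'a) \<Rightarrow> ('a \<Rightarrow> real) \<Rightarrow> 'a set \<Rightarrow> real \<Rightarrow> ereal" where
  "bowen_pressure_eps X T f Z eps = Inf {ereal s | s. bowen_m X T f Z s eps = 0}"

definition bowen_pressure :: "'a::metric_space set \<Rightarrow> ('a \<Rightarrow> 'a) \<Rightarrow> ('a \<Rightarrow> real) \<Rightarrow> 'a set \<Rightarrow> ereal" where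
  "bowen_pressure X T f Z = Lim (at_right 0) (\<lambda>eps. bowen_pressure_eps X T f Z eps)"

definition zero_dimensional :: "'a::metric_space set \<Rightarrow> bool" where
  "zero_dimensional X \<longleftrightarrow> (\<forall>\<delta>>0. \<exists>P. \<Union>P = X \<and> {} \<notin> P \<and>
       (\<forall>A\<in>P. \<forall>B\<in>P. A \<noteq> B \<longrightarrow> A \<inter> B = {}) \<and>
       (\<forall>A\<in>P. openin (top_of_set X) A \<and> closedin (top_of_set X) A \<and> diameter A < \<delta>))"

definition analytic_set :: "'a::topological_space set \<Rightarrow> bool" where
  "analytic_set Z \<longleftrightarrow> (\<exists>g :: (nat \<Rightarrow> nat) \<Rightarrow> 'a. continuous_on UNIV g \<and> range g = Z)"

end

theory Submission
  imports Defs "HOL-Library.Sublist"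
begin

text \<open>A fine clopen partition codes the points of \<open>X\<close> by their itineraries. Up to an error \<open>c\<close> in the
  exponent, where \<open>c\<close> bounds the oscillation of \<open>f\<close> at the given scale, covers by Bowen balls amount
  to covers by cylinders, i.e. by finite words. Two cylinders are nested or disjoint, so covers can be
  merged, and hence the weighted cylinder covering number is continuous along increasing unions
  (no such property is available for balls). If \<open>Z\<close> is the image of Baire space under \<open>g\<close>, one can
  then bound the coordinates one at a time while losing almost nothing. The resulting box \<open>L\<close> is
  compact, and a cover of \<open>g ` L\<close> by open cylinders already covers the image of one of the boxes with
  finitely many bounded coordinates; hence \<open>g ` L\<close> has almost full covering number.\<close>

subsection \<open>Covers by words\<close>

lemma ennreal_summable_on [simp]:
  fixes f :: "'a \<Rightarrow> ennreal"
  shows "f summable_on A"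
  by (rule nonneg_summable_on_complete) simp

lemma infsum_ennreal_mono_set:
  fixes f :: "'a \<Rightarrow> ennreal"
  assumes "A \<subseteq> B"
  shows "infsum f A \<le> infsum f B"
  using assms by (intro infsum_mono_neutral) auto

text \<open>On a set of representatives of the fibres \<open>h\<close> is injective, so the sum can
  be reindexed there; the remaining terms are nonnegative. Hence a cover may be translated by a map
  that identifies some of its members without raising its cost.\<close>

lemma infsum_ennreal_image_le:
  fixes f :: "'b \<Rightarrow> ennreal"
  shows "infsum f (h ` A) \<le> infsum (\<lambda>x. f (h x)) A"
proof -
  obtain B where B: "B \<subseteq> A" "inj_on h B" "h ` A = h ` B"
    using subset_image_inj[of "h ` A" h A] by auto
  have "infsum f (h ` A) = infsum (\<lambda>x. f (h x)) B"
    using infsum_reindex[OF B(2), of f] B(3) by (simp add: o_def)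
  also have "\<dots> \<le> infsum (\<lambda>x. f (h x)) A"
    by (rule infsum_ennreal_mono_set[OF B(1)])
  finally show ?thesis .
qed

lemma infsum_ennreal_split:
  fixes f :: "'a \<Rightarrow> ennreal"
  shows "infsum f {x\<in>A. P x} + infsum f {x\<in>A. \<not> P x} = infsum f A"
proof -
  have "A = {x\<in>A. P x} \<union> {x\<in>A. \<not> P x}" by auto
  moreover have "infsum f ({x\<in>A. P x} \<union> {x\<in>A. \<not> P x}) = infsum f {x\<in>A. P x} + infsum f {x\<in>A. \<not> P x}"
    by (intro infsum_Un_disjoint) auto
  ultimately show ?thesis by simp
qed

lemma infsum_ennreal_Un_le:
  fixes f :: "'a \<Rightarrow> ennreal"
  shows "infsum f (A \<union> B) \<le> infsum f A + infsum f B"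
proof -
  have "infsum f (A \<union> B) = infsum f (A \<union> (B - A))" by (simp add: Un_Diff_cancel)
  also have "\<dots> = infsum f A + infsum f (B - A)"
    by (intro infsum_Un_disjoint) auto
  also have "\<dots> \<le> infsum f A + infsum f B"
    by (intro add_left_mono infsum_ennreal_mono_set) auto
  finally show ?thesis .
qed

section \<open>Words, cylinders and their outer measure\<close>

lemma take_map_upt: "m \<le> n \<Longrightarrow> take m (map \<xi> [0..<n]) = map \<xi> [0..<m]"
  by (simp add: take_map)

lemma prefix_map_upt_iff:
  "prefix u (map \<xi> [0..<n]) \<longleftrightarrow> length u \<le> n \<and> u = map \<xi> [0..<length u]"
proof
  assume p: "prefix u (map \<xi> [0..<n])"
  then have len: "length u \<le> n" using prefix_length_le by fastforce
  from p have "u = take (length u) (map \<xi> [0..<n])" by (auto simp: prefix_def)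
  with len show "length u \<le> n \<and> u = map \<xi> [0..<length u]"
    by (simp only: take_map_upt simp_thms)
next
  assume u: "length u \<le> n \<and> u = map \<xi> [0..<length u]"
  then have "take (length u) (map \<xi> [0..<n]) = u" by (simp only: take_map_upt)
  then show "prefix u (map \<xi> [0..<n])"
    by (metis take_is_prefix)
qed

text \<open>A word stands for the cylinder of all sequences that begin with it.\<close>

definition covers_words :: "'b list set \<Rightarrow> (nat \<Rightarrow> 'b) set \<Rightarrow> bool" where
  "covers_words \<Gamma> E \<longleftrightarrow> (\<forall>\<xi>\<in>E. \<exists>n. map \<xi> [0..<n] \<in> \<Gamma>)"

definition word_covers :: "nat \<Rightarrow> (nat \<Rightarrow> 'b) set \<Rightarrow> 'b list set set" where
  "word_covers N E = {\<Gamma>. countable \<Gamma> \<and> (\<forall>u\<in>\<Gamma>. N \<le> length u) \<and> covers_words \<Gamma> E}"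

text \<open>The outer measure of Caratheodory's covering construction, with weighted cylinders. The
  minimal length \<open>N\<close> stays fixed, as in a Hausdorff pre-measure.\<close>

definition word_measure :: "('b list \<Rightarrow> ennreal) \<Rightarrow> nat \<Rightarrow> (nat \<Rightarrow> 'b) set \<Rightarrow> ennreal" where
  "word_measure w N E = (INF \<Gamma>\<in>word_covers N E. infsum w \<Gamma>)"

lemma word_measure_le: "\<Gamma> \<in> word_covers N E \<Longrightarrow> word_measure w N E \<le> infsum w \<Gamma>"
  unfolding word_measure_def by (rule INF_lower)

lemma word_measure_mono: "E \<subseteq> F \<Longrightarrow> word_measure w N E \<le> word_measure w N F"
  unfolding word_measure_def
  by (rule INF_superset_mono) (auto simp: word_covers_def covers_words_def)

section \<open>Merging two covers\<close>

definition fresh_words :: "'b list set \<Rightarrow> 'b list set \<Rightarrow> 'b list set" where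
  "fresh_words \<Lambda> \<Gamma> = {u\<in>\<Gamma>. \<not> (\<exists>v\<in>\<Lambda>. prefix v u)}"

text \<open>Comparable cylinders are nested, so the larger one suffices: a word of
  \<open>\<Gamma>\<close> gives way to a prefix in \<open>\<Lambda>\<close>, and a word of
  \<open>\<Lambda>\<close> gives way to a fresh prefix.\<close>

definition merge_words :: "'b list set \<Rightarrow> 'b list set \<Rightarrow> 'b list set" where
  "merge_words \<Lambda> \<Gamma> = fresh_words \<Lambda> \<Gamma> \<union> {v\<in>\<Lambda>. \<not> (\<exists>u\<in>fresh_words \<Lambda> \<Gamma>. prefix u v)}"

text \<open>A word of \<open>\<Lambda>\<close> is lost only to a fresh prefix, which is again an
  initial segment of \<open>\<xi>\<close>. Under repeated merging the shortest covering length of a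
  point therefore never grows.\<close>

lemma merge_words_shorter:
  assumes "map \<xi> [0..<n] \<in> \<Lambda>"
  shows "\<exists>m\<le>n. map \<xi> [0..<m] \<in> merge_words \<Lambda> \<Gamma>"
proof (cases "\<exists>u\<in>fresh_words \<Lambda> \<Gamma>. prefix u (map \<xi> [0..<n])")
  case True
  then obtain u where u: "u \<in> fresh_words \<Lambda> \<Gamma>" "length u \<le> n \<and> u = map \<xi> [0..<length u]"
    unfolding prefix_map_upt_iff by blast
  then have "map \<xi> [0..<length u] \<in> merge_words \<Lambda> \<Gamma>"
    unfolding merge_words_def by simp
  with u show ?thesis by blast
next
  case False
  then show ?thesis using assms by (auto simp: merge_words_def)
qed

text \<open>A covering word of \<open>\<Gamma>\<close> is either fresh, and then survives, or has a
  prefix in \<open>\<Lambda>\<close>, to which \<open>merge_words_shorter\<close> applies.\<close>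

lemma covers_merge_words:
  assumes "covers_words \<Gamma> E"
  shows "covers_words (merge_words \<Lambda> \<Gamma>) E"
  unfolding covers_words_def
proof
  fix \<xi> assume "\<xi> \<in> E"
  then obtain n where n: "map \<xi> [0..<n] \<in> \<Gamma>" using assms by (auto simp: covers_words_def)
  show "\<exists>n. map \<xi> [0..<n] \<in> merge_words \<Lambda> \<Gamma>"
  proof (cases "map \<xi> [0..<n] \<in> fresh_words \<Lambda> \<Gamma>")
    case True then show ?thesis unfolding merge_words_def by blast
  next
    case False
    then obtain v where v: "v \<in> \<Lambda>" "prefix v (map \<xi> [0..<n])"
      using n by (auto simp: fresh_words_def)
    then have "map \<xi> [0..<length v] \<in> \<Lambda>" by (metis prefix_map_upt_iff)
    from merge_words_shorter[OF this] show ?thesis by blast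
  qed
qed

text \<open>The words discarded from the two covers together still cover \<open>E\<close>, so they cost at least
  \<open>word_measure w N E\<close>.\<close>

lemma infsum_merge_words_le:
  assumes \<Lambda>: "\<Lambda> \<in> word_covers N E" and \<Gamma>: "\<Gamma> \<in> word_covers N F" and "E \<subseteq> F"
  shows "infsum w (merge_words \<Lambda> \<Gamma>) + word_measure w N E \<le> infsum w \<Gamma> + infsum w \<Lambda>"
proof -
  define A where "A = fresh_words \<Lambda> \<Gamma>"
  define B where "B = {u\<in>\<Gamma>. \<exists>v\<in>\<Lambda>. prefix v u}"
  define R where "R = {v\<in>\<Lambda>. \<not> (\<exists>u\<in>A. prefix u v)}"
  define D where "D = {v\<in>\<Lambda>. \<exists>u\<in>A. prefix u v}"
  have AB: "infsum w B + infsum w A = infsum w \<Gamma>"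
    unfolding A_def B_def fresh_words_def by (rule infsum_ennreal_split)
  have DR: "infsum w D + infsum w R = infsum w \<Lambda>"
    unfolding D_def R_def by (rule infsum_ennreal_split)
  have "B \<union> D \<in> word_covers N E"
  proof -
    have "covers_words (B \<union> D) E"
      unfolding covers_words_def
    proof
      fix \<xi> assume "\<xi> \<in> E"
      then obtain n m where n: "map \<xi> [0..<n] \<in> \<Gamma>" and m: "map \<xi> [0..<m] \<in> \<Lambda>"
        using \<Lambda> \<Gamma> \<open>E \<subseteq> F\<close> unfolding word_covers_def covers_words_def by blast
      show "\<exists>n. map \<xi> [0..<n] \<in> B \<union> D"
      proof (cases "map \<xi> [0..<n] \<in> B")
        case False
        then have "\<not> prefix (map \<xi> [0..<m]) (map \<xi> [0..<n])" using n m by (auto simp: B_def)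
        then have "n \<le> m" by (simp add: prefix_map_upt_iff)
        moreover have "map \<xi> [0..<n] \<in> A" using False n by (auto simp: A_def B_def fresh_words_def)
        ultimately have "map \<xi> [0..<m] \<in> D"
          using m unfolding D_def by (auto simp: prefix_map_upt_iff intro!: bexI[of _ "map \<xi> [0..<n]"])
        then show ?thesis by blast
      qed blast
    qed
    moreover have "B \<subseteq> \<Gamma>" "D \<subseteq> \<Lambda>" by (auto simp: B_def D_def)
    ultimately show ?thesis
      using \<Lambda> \<Gamma> unfolding word_covers_def by (auto intro: countable_subset)
  qed
  then have "word_measure w N E \<le> infsum w B + infsum w D"
    using word_measure_le infsum_ennreal_Un_le order_trans by blast
  moreover have "infsum w (merge_words \<Lambda> \<Gamma>) \<le> infsum w A + infsum w R"
    unfolding merge_words_def A_def R_def by (rule infsum_ennreal_Un_le)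
  ultimately have "infsum w (merge_words \<Lambda> \<Gamma>) + word_measure w N E
      \<le> (infsum w A + infsum w R) + (infsum w B + infsum w D)"
    by (intro add_mono)
  also have "\<dots> = infsum w \<Gamma> + infsum w \<Lambda>"
    by (simp flip: AB DR add: ac_simps)
  finally show ?thesis .
qed

lemma merge_words_in_word_covers:
  assumes "\<Lambda> \<in> word_covers N E" "\<Gamma> \<in> word_covers N F"
  shows "merge_words \<Lambda> \<Gamma> \<in> word_covers N F"
proof -
  have "merge_words \<Lambda> \<Gamma> \<subseteq> \<Lambda> \<union> \<Gamma>" by (auto simp: merge_words_def fresh_words_def)
  then show ?thesis
    using assms covers_merge_words[of \<Gamma> F \<Lambda>] unfolding word_covers_def
    by (auto intro: countable_subset[of _ "\<Lambda> \<union> \<Gamma>"])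
qed

text \<open>Nearly optimal covers of the sets \<open>E k\<close>, with errors of total at most
  \<open>e\<close>, are merged one after another. Each merger saves the cost of the overlap, so only
  the errors add up. The words that stay forever cover the union.\<close>

lemma word_measure_UN_incseq:
  assumes "incseq E"
  shows "word_measure w N (\<Union>k. E k) = (SUP k. word_measure w N (E k))"
proof (rule antisym)
  show "(SUP k. word_measure w N (E k)) \<le> word_measure w N (\<Union>k. E k)"
    by (intro SUP_least word_measure_mono) auto
  let ?S = "SUP k. word_measure w N (E k)"
  show "word_measure w N (\<Union>k. E k) \<le> ?S"
  proof (rule ennreal_le_epsilon)
    fix e :: real assume S: "?S < top" and e: "0 < e"
    define \<delta> where "\<delta> k = e / 2 ^ Suc k" for k
    have \<delta>: "\<delta> k > 0" for k using e by (simp add: \<delta>_def)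
    have fin: "word_measure w N (E k) < top" for k
      using S by (meson SUP_upper UNIV_I le_less_trans)
    have "\<exists>\<Gamma>\<in>word_covers N (E k). infsum w \<Gamma> < word_measure w N (E k) + ennreal (\<delta> k)" for k
    proof -
      have "word_measure w N (E k) < word_measure w N (E k) + ennreal (\<delta> k)"
        using fin[of k] \<delta>[of k]
          ennreal_add_left_cancel_less[of "word_measure w N (E k)" 0 "ennreal (\<delta> k)"] by auto
      then show ?thesis unfolding word_measure_def INF_less_iff .
    qed
    then obtain \<Gamma> where \<Gamma>: "\<And>k. \<Gamma> k \<in> word_covers N (E k)"
      "\<And>k. infsum w (\<Gamma> k) < word_measure w N (E k) + ennreal (\<delta> k)" by metis
    define \<Lambda> where "\<Lambda> = rec_nat (\<Gamma> 0) (\<lambda>k L. merge_words L (\<Gamma> (Suc k)))"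
    have \<Lambda>_simps: "\<Lambda> 0 = \<Gamma> 0" "\<Lambda> (Suc k) = merge_words (\<Lambda> k) (\<Gamma> (Suc k))" for k
      by (simp_all add: \<Lambda>_def)
    have \<Lambda>: "\<Lambda> k \<in> word_covers N (E k)" for k
      by (induction k) (auto simp: \<Lambda>_simps intro: \<Gamma> merge_words_in_word_covers)
    have sum_\<Lambda>: "infsum w (\<Lambda> k) \<le> word_measure w N (E k) + ennreal (\<Sum>i\<le>k. \<delta> i)" for k
    proof (induction k)
      case 0 then show ?case using \<Gamma>(2)[of 0] by (simp add: \<Lambda>_simps)
    next
      case (Suc k)
      let ?\<sigma> = "ennreal (\<Sum>i\<le>k. \<delta> i)"
      \<comment> \<open>The measure of \<open>E k\<close> bounds the discarded cost from below and
        is also the main term in the bound for \<open>\<Lambda> k\<close>, so it cancels.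
        Cancellation in \<open>ennreal\<close> rests on \<open>fin\<close>.\<close>
      have "infsum w (\<Lambda> (Suc k)) + word_measure w N (E k) \<le> infsum w (\<Gamma> (Suc k)) + infsum w (\<Lambda> k)"
        unfolding \<Lambda>_simps by (rule infsum_merge_words_le[OF \<Lambda> \<Gamma>(1) incseq_SucD[OF assms]])
      also have "\<dots> \<le> (word_measure w N (E (Suc k)) + ennreal (\<delta> (Suc k))) + (word_measure w N (E k) + ?\<sigma>)"
        using \<Gamma>(2)[of "Suc k"] Suc.IH by (intro add_mono) auto
      also have "\<dots> = word_measure w N (E k) + (word_measure w N (E (Suc k)) + (?\<sigma> + ennreal (\<delta> (Suc k))))"
        by (simp add: ac_simps)
      also have "?\<sigma> + ennreal (\<delta> (Suc k)) = ennreal (\<Sum>i\<le>Suc k. \<delta> i)"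
        using \<delta> by (simp add: sum_nonneg less_imp_le flip: ennreal_plus)
      finally show ?case
        using fin[of k] unfolding add.commute[of "infsum w (\<Lambda> (Suc k))"]
        by (simp only: ennreal_add_left_cancel_le) auto
    qed
    have sum_\<delta>: "(\<Sum>i\<le>k. \<delta> i) \<le> e" for k
    proof -
      have "(\<Sum>i\<le>k. \<delta> i) = e - e / 2 ^ Suc k"
        by (induction k) (simp_all add: \<delta>_def field_simps)
      then show ?thesis using e by simp
    qed
    have bound: "infsum w (\<Lambda> k) \<le> ?S + ennreal e" for k
      by (rule order_trans[OF sum_\<Lambda>]) (intro add_mono SUP_upper ennreal_leI sum_\<delta> UNIV_I)
    \<comment> \<open>The limit inferior of the merged covers.\<close>
    define \<Omega> where "\<Omega> = {u. \<exists>k0. \<forall>k\<ge>k0. u \<in> \<Lambda> k}"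
    have "infsum w \<Omega> \<le> ?S + ennreal e"
    proof (subst nonneg_infsum_complete, simp, rule SUP_least, safe)
      \<comment> \<open>Finitely many permanent words lie together in one
        \<open>\<Lambda> K\<close>, and the infinite sum is the supremum of such finite
        sums.\<close>
      fix F assume F: "finite F" "F \<subseteq> \<Omega>"
      then obtain k0 where k0: "\<And>u k. u \<in> F \<Longrightarrow> k \<ge> k0 u \<Longrightarrow> u \<in> \<Lambda> k"
        unfolding \<Omega>_def by (simp add: subset_iff) metis
      define K where "K = Max (insert 0 (k0 ` F))"
      have "F \<subseteq> \<Lambda> K" using k0 F(1) by (auto simp: K_def)
      have "sum w F = infsum w F" using F by simp
      also have "\<dots> \<le> infsum w (\<Lambda> K)" by (rule infsum_ennreal_mono_set) fact
      also have "\<dots> \<le> ?S + ennreal e" by (rule bound)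
      finally show "sum w F \<le> ?S + ennreal e" .
    qed
    moreover have "\<Omega> \<in> word_covers N (\<Union>k. E k)"
    proof -
      have sub: "\<Omega> \<subseteq> (\<Union>k. \<Lambda> k)" by (auto simp: \<Omega>_def)
      have "countable (\<Union>k. \<Lambda> k)" using \<Lambda> by (auto simp: word_covers_def)
      then have "countable \<Omega>" using sub countable_subset by blast
      moreover have "\<forall>u\<in>\<Omega>. N \<le> length u" using sub \<Lambda> unfolding word_covers_def by blast
      moreover have "covers_words \<Omega> (\<Union>k. E k)"
        unfolding covers_words_def
      proof safe
        fix \<xi> k0 assume "\<xi> \<in> E k0"
        then have "\<xi> \<in> E k" if "k \<ge> k0" for k using assms that by (auto simp: incseq_def)
        then have ex: "\<exists>n. map \<xi> [0..<n] \<in> \<Lambda> k" if "k \<ge> k0" for k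
          using \<Lambda>[of k] that by (auto simp: word_covers_def covers_words_def)
        \<comment> \<open>Once the shortest covering length is constant, one and the same initial
          segment of \<open>\<xi>\<close> lies in all later covers, hence in
          \<open>\<Omega>\<close>.\<close>
        define l where "l k = (LEAST n. map \<xi> [0..<n] \<in> \<Lambda> (k0 + k))" for k
        have l: "map \<xi> [0..<l k] \<in> \<Lambda> (k0 + k)" for k
          unfolding l_def by (rule LeastI_ex) (use ex in auto)
        have "l (Suc k) \<le> l k" for k
          using merge_words_shorter[OF l[of k], of "\<Gamma> (Suc (k0 + k))"]
          unfolding \<Lambda>_simps(2)[symmetric]
          unfolding l_def[of "Suc k"] by (metis Least_le add_Suc_right order_trans)
        then have anti: "l k' \<le> l k" if "k \<le> k'" for k k'
          using that by (rule lift_Suc_antimono_le)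
        \<comment> \<open>the lengths decrease, hence stabilise\<close>
        define n where "n = (LEAST n. n \<in> range l)"
        obtain K where K: "n = l K" unfolding n_def by (metis LeastI rangeE rangeI)
        have "l k = n" if "k \<ge> K" for k
          using anti[OF that] K unfolding n_def by (metis Least_le le_antisym rangeI)
        then have "map \<xi> [0..<n] \<in> \<Lambda> k" if "k \<ge> k0 + K" for k
          using l[of "k - k0"] that by simp
        then show "\<exists>n. map \<xi> [0..<n] \<in> \<Omega>" unfolding \<Omega>_def by blast
      qed
      ultimately show ?thesis by (simp add: word_covers_def)
    qed
    ultimately show "word_measure w N (\<Union>k. E k) \<le> ?S + ennreal e"
      using word_measure_le order_trans by blast
  qed
qed

subsection \<open>Inner regularity on images of Baire space\<close>

text \<open>Tychonoff's theorem for finite discrete factors.\<close>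

lemma compact_nat_box: "compact {z :: nat \<Rightarrow> nat. \<forall>i. z i \<le> b i}"
proof -
  have "compactin (product_topology (\<lambda>i. euclidean :: nat topology) UNIV) (PiE UNIV (\<lambda>i. {..b i}))"
    by (subst compactin_PiE) (auto simp: finite_imp_compact)
  then have "compact (PiE UNIV (\<lambda>i. {..b i}))"
    by (simp add: euclidean_product_topology)
  then show ?thesis
    by (simp add: PiE_UNIV_domain Pi_def)
qed

lemma map_upt_eq_iff: "map \<xi> [0..<length u] = u \<longleftrightarrow> (\<forall>i<length u. \<xi> i = u ! i)"
  by (subst list_eq_iff_nth_eq) auto

text \<open>A word constrains only finitely many coordinates, so the points it covers form a finite
  intersection of open level sets.\<close>

lemma open_covered_words:
  fixes h :: "'c::topological_space \<Rightarrow> nat \<Rightarrow> 'b"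
  assumes "\<And>i a. open {z. h z i = a}"
  shows "open {z. \<exists>n. map (h z) [0..<n] \<in> \<Gamma>}"
proof -
  have eq: "{z. \<exists>n. map (h z) [0..<n] \<in> \<Gamma>} = (\<Union>u\<in>\<Gamma>. \<Inter>i\<in>{..<length u}. {z. h z i = u ! i})"
  proof (rule set_eqI)
    fix z
    have "(\<exists>n. map (h z) [0..<n] \<in> \<Gamma>) \<longleftrightarrow> (\<exists>u\<in>\<Gamma>. map (h z) [0..<length u] = u)"
      by (metis diff_zero length_map length_upt)
    also have "\<dots> \<longleftrightarrow> (\<exists>u\<in>\<Gamma>. \<forall>i<length u. h z i = u ! i)"
      by (simp only: map_upt_eq_iff)
    finally show "z \<in> {z. \<exists>n. map (h z) [0..<n] \<in> \<Gamma>} \<longleftrightarrow>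
        z \<in> (\<Union>u\<in>\<Gamma>. \<Inter>i\<in>{..<length u}. {z. h z i = u ! i})" by auto
  qed
  show ?thesis unfolding eq using assms by (intro open_UN ballI open_INT) auto
qed

text \<open>A capacitability argument in the style of Choquet. One fixed \<open>t\<close> is kept
  strictly below the measure at every finite stage, so no errors accumulate; strictness is given up
  only for the box \<open>L\<close> itself.\<close>

lemma word_measure_compact_inner:
  fixes h :: "(nat \<Rightarrow> nat) \<Rightarrow> nat \<Rightarrow> 'b"
  assumes loc: "\<And>i a. open {z. h z i = a}" and pos: "t < word_measure w N (range h)"
  shows "\<exists>L. compact L \<and> t \<le> word_measure w N (h ` L)"
proof -
  have step: "\<exists>n. t < word_measure w N (h ` (A \<inter> {z. z p \<le> n}))"
    if "t < word_measure w N (h ` A)" for A and p :: nat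
  proof -
    have "incseq (\<lambda>n. h ` (A \<inter> {z. z p \<le> n}))" by (rule incseq_SucI) auto
    moreover have "h ` A = (\<Union>n. h ` (A \<inter> {z. z p \<le> n}))" by auto
    ultimately show ?thesis
      using that by (simp only: word_measure_UN_incseq less_SUP_iff) auto
  qed
  \<comment> \<open>Stage \<open>p\<close> bounds coordinate \<open>p\<close>. The clause for
    \<open>p = 0\<close> makes the chosen sequence start at the whole space.\<close>
  have "\<exists>A. \<forall>p. t < word_measure w N (h ` A p) \<and> (p = 0 \<longrightarrow> A p = UNIV) \<and>
      (\<exists>n. A (Suc p) = A p \<inter> {z. z p \<le> n})"
    using dependent_nat_choice[of "\<lambda>p A. t < word_measure w N (h ` A) \<and> (p = 0 \<longrightarrow> A = UNIV)"
        "\<lambda>p A B. \<exists>n. B = A \<inter> {z. z p \<le> n}"] pos step by (simp add: conj_assoc) blast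
  then obtain A where A: "\<And>p. t < word_measure w N (h ` A p)" "A 0 = UNIV"
    "\<And>p. \<exists>n. A (Suc p) = A p \<inter> {z. z p \<le> n}" by blast
  then obtain b where b: "\<And>p. A (Suc p) = A p \<inter> {z. z p \<le> b p}" by metis
  have A_eq: "A p = {z. \<forall>i<p. z i \<le> b i}" for p
    by (induction p) (auto simp: A(2) b less_Suc_eq)
  define L where "L = {z. \<forall>i. z i \<le> b i}"
  have "compact L" unfolding L_def by (rule compact_nat_box)
  moreover have "t \<le> word_measure w N (h ` L)"
    unfolding word_measure_def
  proof (rule INF_greatest)
    fix \<Gamma> assume \<Gamma>: "\<Gamma> \<in> word_covers N (h ` L)"
    define V where "V = {z. \<exists>n. map (h z) [0..<n] \<in> \<Gamma>}"
    have "open V" unfolding V_def using loc by (rule open_covered_words)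
    have "L \<subseteq> V" using \<Gamma> by (auto simp: V_def word_covers_def covers_words_def)
    \<comment> \<open>Otherwise pick \<open>z p\<close> in \<open>A p\<close> outside
      \<open>V\<close> and truncate it to a point \<open>y p\<close> of \<open>L\<close>. The two
      agree below \<open>p\<close>, so along a subsequence both converge to the same point of
      \<open>L\<close>, which lies in the open set \<open>V\<close>.\<close>
    have "\<exists>p. A p \<subseteq> V"
    proof (rule ccontr)
      assume "\<not> ?thesis"
      then have "\<forall>p. \<exists>z. z \<in> A p \<and> z \<notin> V" by blast
      then obtain z where z: "\<And>p. z p \<in> A p" "\<And>p. z p \<notin> V" by metis
      define y where "y p i = min (z p i) (b i)" for p i
      have "\<forall>p. y p \<in> L" by (auto simp: y_def L_def)
      moreover have "seq_compact L" using \<open>compact L\<close> by (rule compact_imp_seq_compact)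
      ultimately obtain l r where l: "l \<in> L" and r: "strict_mono r" and yl: "(y \<circ> r) \<longlonglongrightarrow> l"
        by (metis seq_compactE)
      have "(z \<circ> r) \<longlonglongrightarrow> l"
      proof -
        have "limitin (product_topology (\<lambda>i. euclidean) UNIV) (z \<circ> r) l sequentially"
          unfolding limitin_componentwise
        proof (intro conjI ballI)
          fix i
          have "limitin (product_topology (\<lambda>i. euclidean) UNIV) (y \<circ> r) l sequentially"
            using yl by (simp add: euclidean_product_topology)
          then have "(\<lambda>p. (y \<circ> r) p i) \<longlonglongrightarrow> l i" by (simp add: limitin_componentwise)
          moreover have "\<forall>\<^sub>F p in sequentially. (y \<circ> r) p i = (z \<circ> r) p i"
            using eventually_gt_at_top[of i]
          proof eventually_elim
            case (elim p)
            then have "i < r p" using seq_suble[OF r, of p] by linarith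
            then show ?case using z(1)[of "r p"] by (auto simp: A_eq y_def)
          qed
          ultimately show "limitin euclidean (\<lambda>p. (z \<circ> r) p i) (l i) sequentially"
            by (simp add: tendsto_cong)
        qed auto
        then show ?thesis by (simp add: euclidean_product_topology)
      qed
      then have "\<forall>\<^sub>F p in sequentially. (z \<circ> r) p \<in> V"
        using \<open>open V\<close> by (rule topological_tendstoD) (use l \<open>L \<subseteq> V\<close> in blast)
      then show False using z(2) by simp
    qed
    then obtain p where "A p \<subseteq> V" ..
    then have "\<Gamma> \<in> word_covers N (h ` A p)"
      using \<Gamma> by (auto simp: V_def word_covers_def covers_words_def)
    then have "word_measure w N (h ` A p) \<le> infsum w \<Gamma>" by (rule word_measure_le)
    then show "t \<le> infsum w \<Gamma>" using A(1)[of p] by order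
  qed
  ultimately show ?thesis by blast
qed

subsection \<open>Bowen balls and pressure\<close>

lemma bowen_dist_less_iff:
  "1 \<le> n \<Longrightarrow> bowen_dist T n x y < e \<longleftrightarrow> (\<forall>i<n. dist ((T ^^ i) x) ((T ^^ i) y) < e)"
  unfolding bowen_dist_def by (subst Max_less_iff) auto

lemma funpow_in:
  assumes "T ` X \<subseteq> X" "x \<in> X"
  shows "(T ^^ i) x \<in> X"
  using assms by (induction i) auto

text \<open>Along orbits that stay \<open>e\<close>-close, \<open>c\<close> is the error in the
  exponent per unit of time.\<close>

definition osc_le :: "'a::metric_space set \<Rightarrow> ('a \<Rightarrow> real) \<Rightarrow> real \<Rightarrow> real \<Rightarrow> bool" where
  "osc_le X f e c \<longleftrightarrow> (\<forall>u\<in>X. \<forall>v\<in>X. dist u v < e \<longrightarrow> \<bar>f u - f v\<bar> \<le> c)"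

lemma osc_le_mono: "osc_le X f e c \<Longrightarrow> e' \<le> e \<Longrightarrow> osc_le X f e' c"
  by (auto simp: osc_le_def)

lemma ex_osc_le:
  assumes "compact X" "continuous_on X f" "0 < c"
  shows "\<exists>e>0. osc_le X f e c"
proof -
  have "uniformly_continuous_on X f" using assms by (intro compact_uniformly_continuous)
  then obtain e where "e > 0" "\<forall>x\<in>X. \<forall>y\<in>X. dist y x < e \<longrightarrow> dist (f y) (f x) < c"
    using \<open>0 < c\<close> unfolding uniformly_continuous_on_def by blast
  then show ?thesis unfolding osc_le_def by (auto simp: dist_real_def intro!: exI[of _ e] less_imp_le)
qed

lemma birkhoff_sum_le:
  assumes "osc_le X f e c" "T ` X \<subseteq> X" "x \<in> X" "y \<in> X"
    and "\<And>i. i < n \<Longrightarrow> dist ((T ^^ i) x) ((T ^^ i) y) < e"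
  shows "birkhoff_sum T f n y \<le> birkhoff_sum T f n x + c * real n"
proof -
  have "f ((T ^^ i) y) \<le> f ((T ^^ i) x) + c" if "i < n" for i
  proof -
    have "\<bar>f ((T ^^ i) x) - f ((T ^^ i) y)\<bar> \<le> c"
      using assms(1) funpow_in[OF assms(2)] assms(3-5) that unfolding osc_le_def by blast
    then show ?thesis by linarith
  qed
  then have "birkhoff_sum T f n y \<le> (\<Sum>i<n. f ((T ^^ i) x) + c)"
    unfolding birkhoff_sum_def by (intro sum_mono) auto
  then show ?thesis by (simp add: birkhoff_sum_def sum.distrib mult.commute)
qed

lemma bowen_ball_centre: "1 \<le> n \<Longrightarrow> 0 < e \<Longrightarrow> x \<in> X \<Longrightarrow> x \<in> bowen_ball X T n x e"
  by (simp add: bowen_ball_def bowen_dist_less_iff)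

lemma birkhoff_sum_bowen_ball_le:
  assumes "osc_le X f e c" "T ` X \<subseteq> X" "x \<in> X" "1 \<le> n" "y \<in> bowen_ball X T n x e"
  shows "birkhoff_sum T f n y \<le> birkhoff_sum T f n x + c * real n"
  using assms by (intro birkhoff_sum_le) (auto simp: bowen_ball_def bowen_dist_less_iff)

text \<open>A real supremum dominates its members only if the set is bounded above; the oscillation
  bound provides this.\<close>

lemma SUP_bowen_ball_ge:
  assumes "osc_le X f e c" "T ` X \<subseteq> X" "x \<in> X" "1 \<le> n" "0 < e"
  shows "birkhoff_sum T f n x \<le> (SUP y\<in>bowen_ball X T n x e. birkhoff_sum T f n y)"
proof (rule cSUP_upper)
  show "x \<in> bowen_ball X T n x e" using assms by (intro bowen_ball_centre)
  show "bdd_above (birkhoff_sum T f n ` bowen_ball X T n x e)"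
    using birkhoff_sum_bowen_ball_le[OF assms(1-4)] by (rule bdd_aboveI2)
qed

lemma SUP_bowen_ball_le:
  assumes "osc_le X f e c" "T ` X \<subseteq> X" "x \<in> X" "1 \<le> n" "0 < e"
  shows "(SUP y\<in>bowen_ball X T n x e. birkhoff_sum T f n y) \<le> birkhoff_sum T f n x + c * real n"
proof (rule cSUP_least)
  show "bowen_ball X T n x e \<noteq> {}" using assms bowen_ball_centre by blast
qed (rule birkhoff_sum_bowen_ball_le[OF assms(1-4)])

section \<open>Change of scale, exponent and level\<close>

definition ball_weight :: "'a::metric_space set \<Rightarrow> ('a \<Rightarrow> 'a) \<Rightarrow> ('a \<Rightarrow> real) \<Rightarrow> real \<Rightarrow> real \<Rightarrow> 'a \<times> nat \<Rightarrow> ennreal" where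
  "ball_weight X T f s e = (\<lambda>(x, n). ennreal (exp (- s * real n
     + (SUP y\<in>bowen_ball X T n x e. birkhoff_sum T f n y))))"

lemma bowen_M_eq: "bowen_M X T f Z s N e = (INF \<Gamma>\<in>bowen_covers X T Z N e. infsum (ball_weight X T f s e) \<Gamma>)"
  unfolding bowen_M_def ball_weight_def ..

text \<open>The same centres and lengths give a cover at scale \<open>e2\<close>. Through the value
  at the centre, passing to the larger ball raises the supremum by at most
  \<open>c * real n\<close>, which the larger exponent absorbs.\<close>

lemma bowen_M_change_scale_le:
  assumes "osc_le X f e2 c" "T ` X \<subseteq> X" "0 < e1" "e1 \<le> e2" "1 \<le> N"
  shows "bowen_M X T f Z (s + c) N e2 \<le> bowen_M X T f Z s N e1"
  unfolding bowen_M_eq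
proof (rule INF_mono)
  fix \<Gamma> assume \<Gamma>: "\<Gamma> \<in> bowen_covers X T Z N e1"
  have "bowen_ball X T n x e1 \<subseteq> bowen_ball X T n x e2" for x n
    using \<open>e1 \<le> e2\<close> by (auto simp: bowen_ball_def)
  then have "(\<Union>(x, n)\<in>\<Gamma>. bowen_ball X T n x e1) \<subseteq> (\<Union>(x, n)\<in>\<Gamma>. bowen_ball X T n x e2)"
    by (intro UN_mono order_refl) (simp add: split_beta)
  then have "\<Gamma> \<in> bowen_covers X T Z N e2"
    using \<Gamma> unfolding bowen_covers_def by blast
  moreover have "ball_weight X T f (s + c) e2 v \<le> ball_weight X T f s e1 v" if v: "v \<in> \<Gamma>" for v
  proof -
    obtain x n where xn: "v = (x, n)" by (cases v)
    have x: "x \<in> X" and n: "1 \<le> n" using \<Gamma> v xn \<open>1 \<le> N\<close> by (auto simp: bowen_covers_def)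
    have "(SUP y\<in>bowen_ball X T n x e2. birkhoff_sum T f n y) \<le> birkhoff_sum T f n x + c * real n"
      using assms x n by (intro SUP_bowen_ball_le) auto
    moreover have "birkhoff_sum T f n x \<le> (SUP y\<in>bowen_ball X T n x e1. birkhoff_sum T f n y)"
      using assms x n osc_le_mono by (intro SUP_bowen_ball_ge) auto
    ultimately show ?thesis
      unfolding xn ball_weight_def by (auto intro!: ennreal_leI simp: algebra_simps)
  qed
  ultimately show "\<exists>\<Gamma>'\<in>bowen_covers X T Z N e2. infsum (ball_weight X T f (s + c) e2) \<Gamma>'
      \<le> infsum (ball_weight X T f s e1) \<Gamma>"
    by (intro bexI[of _ \<Gamma>] infsum_mono) auto
qed

lemma bowen_M_antimono:
  assumes "s \<le> s'"
  shows "bowen_M X T f Z s' N e \<le> bowen_M X T f Z s N e"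
  unfolding bowen_M_eq
proof (rule INF_mono)
  fix \<Gamma> assume "\<Gamma> \<in> bowen_covers X T Z N e"
  moreover have "ball_weight X T f s' e v \<le> ball_weight X T f s e v" for v
    using assms by (auto simp: ball_weight_def mult_right_mono intro!: ennreal_leI split: prod.split)
  ultimately show "\<exists>\<Gamma>'\<in>bowen_covers X T Z N e. infsum (ball_weight X T f s' e) \<Gamma>'
      \<le> infsum (ball_weight X T f s e) \<Gamma>"
    by (intro bexI[of _ \<Gamma>] infsum_mono) auto
qed

lemma bowen_M_mono_level: "N \<le> N' \<Longrightarrow> bowen_M X T f Z s N e \<le> bowen_M X T f Z s N' e"
  unfolding bowen_M_eq by (rule INF_superset_mono) (auto simp: bowen_covers_def)

lemma bowen_M_mono: "Y \<subseteq> Z \<Longrightarrow> bowen_M X T f Y s N e \<le> bowen_M X T f Z s N e"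
  unfolding bowen_M_eq by (rule INF_superset_mono) (auto simp: bowen_covers_def)

text \<open>Only levels \<open>N \<ge> 1\<close> are meaningful: \<open>bowen_dist\<close> takes a maximum over the empty set at level \<open>0\<close>.\<close>

lemma bowen_m_eq_0_iff: "bowen_m X T f Z s e = 0 \<longleftrightarrow> (\<forall>N\<ge>1. bowen_M X T f Z s N e = 0)"
proof -
  have "(\<lambda>N. bowen_M X T f Z s N e) \<longlonglongrightarrow> (SUP N. bowen_M X T f Z s N e)"
    by (rule LIMSEQ_SUP) (simp add: bowen_M_mono_level incseq_def)
  then have "bowen_m X T f Z s e = (SUP N. bowen_M X T f Z s N e)"
    unfolding bowen_m_def by (rule limI)
  also have "\<dots> = 0 \<longleftrightarrow> (\<forall>N. bowen_M X T f Z s N e = 0)"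
    by (simp add: SUP_eq_iff flip: bot_ennreal)
  also have "\<dots> \<longleftrightarrow> (\<forall>N\<ge>1. bowen_M X T f Z s N e = 0)"
  proof (intro iffI allI impI)
    fix N assume "\<forall>N\<ge>1. bowen_M X T f Z s N e = 0"
    then have "bowen_M X T f Z s (Suc N) e = 0" by simp
    then show "bowen_M X T f Z s N e = 0"
      using bowen_M_mono_level[of N "Suc N" X T f Z s e] by simp
  qed simp
  finally show ?thesis .
qed

section \<open>Pressure at a fixed scale and its limit\<close>

lemma bowen_pressure_eps_geI:
  assumes "0 < bowen_M X T f Z s N e" "1 \<le> N"
  shows "ereal s \<le> bowen_pressure_eps X T f Z e"
  unfolding bowen_pressure_eps_def
proof (rule Inf_greatest, clarify)
  fix s' assume "bowen_m X T f Z s' e = 0"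
  then have "bowen_M X T f Z s' N e = 0" using assms(2) by (simp add: bowen_m_eq_0_iff)
  then have "\<not> s' \<le> s" using assms(1) bowen_M_antimono[of s' s X T f Z N e] by auto
  then show "ereal s \<le> ereal s'" by simp
qed

text \<open>Together with \<open>bowen_pressure_eps_geI\<close> this turns lower bounds for the
  pressure into positivity of \<open>bowen_M\<close> at a single level, and back.\<close>

lemma bowen_M_pos_of_less_pressure_eps:
  assumes "ereal s < bowen_pressure_eps X T f Z e"
  shows "\<exists>N\<ge>1. 0 < bowen_M X T f Z s N e"
proof (rule ccontr)
  assume "\<not> ?thesis"
  then have "bowen_m X T f Z s e = 0" by (auto simp: bowen_m_eq_0_iff)
  then have "bowen_pressure_eps X T f Z e \<le> ereal s"
    unfolding bowen_pressure_eps_def by (intro Inf_lower) auto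
  with assms show False by simp
qed

lemma bowen_pressure_eps_mono:
  assumes "Y \<subseteq> Z"
  shows "bowen_pressure_eps X T f Y e \<le> bowen_pressure_eps X T f Z e"
  unfolding bowen_pressure_eps_def
proof (rule Inf_superset_mono, clarify)
  fix s assume "bowen_m X T f Z s e = 0"
  then have "bowen_m X T f Y s e = 0"
    unfolding bowen_m_eq_0_iff using bowen_M_mono[OF assms] by (metis le_zero_eq)
  then show "\<exists>s'. ereal s = ereal s' \<and> bowen_m X T f Y s' e = 0" by blast
qed

lemma bowen_pressure_eps_change_scale_le:
  assumes "osc_le X f e2 c" "T ` X \<subseteq> X" "0 < e1" "e1 \<le> e2"
  shows "bowen_pressure_eps X T f Z e2 \<le> bowen_pressure_eps X T f Z e1 + ereal c"
proof -
  have "bowen_pressure_eps X T f Z e2 - ereal c \<le> bowen_pressure_eps X T f Z e1"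
    unfolding bowen_pressure_eps_def[of _ _ _ _ e1]
  proof (rule Inf_greatest, clarify)
    fix s assume "bowen_m X T f Z s e1 = 0"
    then have "bowen_m X T f Z (s + c) e2 = 0"
      unfolding bowen_m_eq_0_iff using bowen_M_change_scale_le[OF assms] by (metis le_zero_eq)
    then have "bowen_pressure_eps X T f Z e2 \<le> ereal (s + c)"
      unfolding bowen_pressure_eps_def by (intro Inf_lower) auto
    then show "bowen_pressure_eps X T f Z e2 - ereal c \<le> ereal s"
      by (subst ereal_minus_le) auto
  qed
  then show ?thesis by (subst (asm) ereal_minus_le) auto
qed

text \<open>\<open>Lim\<close> is meaningful only once convergence is known. The pressure at a scale
  is monotone up to \<open>c\<close> for all small scales, so its upper and lower limits differ by
  at most every \<open>c > 0\<close>.\<close>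

lemma bowen_pressure_tendsto:
  assumes "compact X" "T ` X \<subseteq> X" "continuous_on X f"
  shows "((\<lambda>e. bowen_pressure_eps X T f Z e) \<longlongrightarrow> bowen_pressure X T f Z) (at_right 0)"
proof -
  let ?P = "bowen_pressure_eps X T f Z"
  let ?F = "at_right (0::real)"
  have "Limsup ?F ?P \<le> Liminf ?F ?P"
  proof (rule ereal_le_epsilon2)
    fix c :: real assume "0 < c"
    then obtain e0 where e0: "e0 > 0" "osc_le X f e0 c" using assms ex_osc_le by blast
    \<comment> \<open>First \<open>e1\<close> tends to 0 with \<open>e2\<close> fixed; afterwards
      \<open>e2\<close> tends to 0.\<close>
    have "?P e2 - ereal c \<le> Liminf ?F ?P" if "0 < e2" "e2 < e0" for e2
    proof (rule Liminf_bounded)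
      have "\<forall>\<^sub>F e1 in ?F. e1 \<in> {0<..<e2}" using that by (intro eventually_at_right_real)
      then show "\<forall>\<^sub>F e1 in ?F. ?P e2 - ereal c \<le> ?P e1"
      proof eventually_elim
        case (elim e1)
        then have "?P e2 \<le> ?P e1 + ereal c"
          using that e0 assms osc_le_mono[OF e0(2), of e2]
          by (intro bowen_pressure_eps_change_scale_le) auto
        then show ?case by (subst ereal_minus_le) auto
      qed
    qed
    then have le: "?P e2 \<le> Liminf ?F ?P + ereal c" if "0 < e2" "e2 < e0" for e2
      using that by (subst (asm) ereal_minus_le) auto
    show "Limsup ?F ?P \<le> Liminf ?F ?P + ereal c"
    proof (rule Limsup_bounded)
      have "\<forall>\<^sub>F e2 in ?F. e2 \<in> {0<..<e0}" using e0 by (intro eventually_at_right_real)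
      then show "\<forall>\<^sub>F e2 in ?F. ?P e2 \<le> Liminf ?F ?P + ereal c"
        by eventually_elim (simp add: le)
    qed
  qed
  then have "Liminf ?F ?P = Limsup ?F ?P"
    by (intro antisym Liminf_le_Limsup) auto
  then have "(?P \<longlongrightarrow> Limsup ?F ?P) ?F"
    by (simp add: tendsto_iff_Liminf_eq_Limsup)
  moreover from this have "bowen_pressure X T f Z = Limsup ?F ?P"
    unfolding bowen_pressure_def by (intro tendsto_Lim) auto
  ultimately show ?thesis by simp
qed

subsection \<open>Coding by itineraries\<close>

definition itinerary :: "('a \<Rightarrow> 'a) \<Rightarrow> ('a \<Rightarrow> 'b) \<Rightarrow> 'a \<Rightarrow> nat \<Rightarrow> 'b" where
  "itinerary T q x i = q ((T ^^ i) x)"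

definition realizes :: "'a set \<Rightarrow> ('a \<Rightarrow> 'a) \<Rightarrow> ('a \<Rightarrow> 'b) \<Rightarrow> 'b list \<Rightarrow> 'a \<Rightarrow> bool" where
  "realizes X T q u x \<longleftrightarrow> x \<in> X \<and> map (itinerary T q x) [0..<length u] = u"

text \<open>Junk if no point of \<open>X\<close> realizes \<open>u\<close>, which is harmless: such a word covers nothing.\<close>

definition word_point :: "'a set \<Rightarrow> ('a \<Rightarrow> 'a) \<Rightarrow> ('a \<Rightarrow> 'b) \<Rightarrow> 'b list \<Rightarrow> 'a" where
  "word_point X T q u = (SOME x. realizes X T q u x)"

text \<open>The Birkhoff sum is taken at one point of the cylinder; under an oscillation bound
  another choice changes the exponent by at most \<open>c\<close> per symbol.\<close>

definition word_weight :: "'a set \<Rightarrow> ('a \<Rightarrow> 'a) \<Rightarrow> ('a \<Rightarrow> real) \<Rightarrow> ('a \<Rightarrow> 'b) \<Rightarrow> real \<Rightarrow> 'b list \<Rightarrow> ennreal" where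
  "word_weight X T f q s u = ennreal (exp (- s * real (length u)
     + birkhoff_sum T f (length u) (word_point X T q u)))"

lemma realizes_word_point: "realizes X T q u x \<Longrightarrow> realizes X T q u (word_point X T q u)"
  unfolding word_point_def by (rule someI)

lemma realizes_itinerary: "x \<in> X \<Longrightarrow> realizes X T q (map (itinerary T q x) [0..<n]) x"
  by (simp add: realizes_def)

section \<open>Comparison of cylinders with Bowen balls\<close>

lemma realizes_dist_less:
  assumes "\<And>x y. x \<in> X \<Longrightarrow> y \<in> X \<Longrightarrow> q x = q y \<Longrightarrow> dist x y < d"
    and "T ` X \<subseteq> X" "realizes X T q u x" "realizes X T q u y" "i < length u"
  shows "dist ((T ^^ i) x) ((T ^^ i) y) < d"
proof -
  have "map (itinerary T q x) [0..<length u] ! i = map (itinerary T q y) [0..<length u] ! i"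
    using assms(3,4) by (simp add: realizes_def)
  then have "q ((T ^^ i) x) = q ((T ^^ i) y)" using assms(5) by (simp add: itinerary_def)
  then show ?thesis using assms funpow_in by (metis realizes_def)
qed

text \<open>Points closer than \<open>e\<close> have equal labels, so a Bowen ball of radius
  \<open>e\<close> lies in the cylinder of its centre. Moving from the centre to
  \<open>word_point\<close> costs at most \<open>c\<close> per symbol, which \<open>s + c\<close>
  absorbs.\<close>

lemma word_measure_le_bowen_M:
  assumes q: "\<And>x y. x \<in> X \<Longrightarrow> y \<in> X \<Longrightarrow> q x = q y \<Longrightarrow> dist x y < d"
    and leb: "\<And>x y. x \<in> X \<Longrightarrow> y \<in> X \<Longrightarrow> dist x y < e \<Longrightarrow> q x = q y"
    and osc: "osc_le X f d c" and T: "T ` X \<subseteq> X" and e: "0 < e" "e \<le> d"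
    and "E \<subseteq> X" "1 \<le> N"
  shows "word_measure (word_weight X T f q (s + c)) N (itinerary T q ` E) \<le> bowen_M X T f E s N e"
  unfolding word_measure_def bowen_M_eq
proof (rule INF_mono)
  let ?w = "word_weight X T f q (s + c)"
  define h where "h = (\<lambda>(x, n). map (itinerary T q x) [0..<n])"
  fix \<Gamma> assume \<Gamma>: "\<Gamma> \<in> bowen_covers X T E N e"
  have "h ` \<Gamma> \<in> word_covers N (itinerary T q ` E)"
  proof -
    have "covers_words (h ` \<Gamma>) (itinerary T q ` E)"
      unfolding covers_words_def
    proof safe
      fix y assume "y \<in> E"
      then obtain x n where xn: "(x, n) \<in> \<Gamma>" and y: "y \<in> bowen_ball X T n x e"
        using \<Gamma> unfolding bowen_covers_def by fast
      have "x \<in> X" "1 \<le> n" using \<Gamma> xn \<open>1 \<le> N\<close> by (auto simp: bowen_covers_def)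
      then have "q ((T ^^ i) x) = q ((T ^^ i) y)" if "i < n" for i
        using y that leb funpow_in[OF T] by (auto simp: bowen_ball_def bowen_dist_less_iff)
      then have "map (itinerary T q y) [0..<n] = h (x, n)"
        by (simp add: h_def itinerary_def)
      then show "\<exists>n. map (itinerary T q y) [0..<n] \<in> h ` \<Gamma>" using xn by (metis imageI)
    qed
    then show ?thesis using \<Gamma> by (auto simp: word_covers_def bowen_covers_def h_def)
  qed
  moreover have "infsum ?w (h ` \<Gamma>) \<le> infsum (ball_weight X T f s e) \<Gamma>"
  proof -
    have "infsum ?w (h ` \<Gamma>) \<le> infsum (\<lambda>v. ?w (h v)) \<Gamma>"
      by (rule infsum_ennreal_image_le)
    also have "\<dots> \<le> infsum (ball_weight X T f s e) \<Gamma>"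
    proof (rule infsum_mono)
      fix v assume v: "v \<in> \<Gamma>"
      obtain x n where xn: "v = (x, n)" by (cases v)
      have x: "x \<in> X" and n: "1 \<le> n" using \<Gamma> v xn \<open>1 \<le> N\<close> by (auto simp: bowen_covers_def)
      let ?u = "map (itinerary T q x) [0..<n]"
      let ?p = "word_point X T q ?u"
      have rx: "realizes X T q ?u x" using x by (rule realizes_itinerary)
      then have rp: "realizes X T q ?u ?p" by (rule realizes_word_point)
      have "dist ((T ^^ i) x) ((T ^^ i) ?p) < d" if "i < n" for i
        by (rule realizes_dist_less[OF q T rx rp]) (use that in auto)
      moreover have "?p \<in> X" using rp by (simp add: realizes_def)
      ultimately have "birkhoff_sum T f n ?p \<le> birkhoff_sum T f n x + c * real n"
        by (intro birkhoff_sum_le[OF osc T x])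
      also have "birkhoff_sum T f n x \<le> (SUP y\<in>bowen_ball X T n x e. birkhoff_sum T f n y)"
        using osc_le_mono[OF osc e(2)] T x n e(1) by (rule SUP_bowen_ball_ge)
      finally show "?w (h v) \<le> ball_weight X T f s e v"
        unfolding xn ball_weight_def word_weight_def h_def
        by (auto intro!: ennreal_leI simp: algebra_simps)
    qed auto
    finally show ?thesis .
  qed
  ultimately show "\<exists>\<Gamma>'\<in>word_covers N (itinerary T q ` E).
      infsum ?w \<Gamma>' \<le> infsum (ball_weight X T f s e) \<Gamma>" by blast
qed

text \<open>Conversely, points with equal labels are closer than \<open>d\<close>, so a cylinder
  lies in the Bowen ball of radius \<open>d\<close> about its \<open>word_point\<close>, and the
  supremum over that ball costs at most \<open>c\<close> per symbol.\<close>

lemma bowen_M_le_word_measure: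
  assumes q: "\<And>x y. x \<in> X \<Longrightarrow> y \<in> X \<Longrightarrow> q x = q y \<Longrightarrow> dist x y < d"
    and osc: "osc_le X f d c" and T: "T ` X \<subseteq> X" and "0 < d" "E \<subseteq> X" "1 \<le> N"
  shows "bowen_M X T f E (s + c) N d \<le> word_measure (word_weight X T f q s) N (itinerary T q ` E)"
  unfolding word_measure_def bowen_M_eq
proof (rule INF_mono)
  let ?w = "word_weight X T f q s"
  define h where "h u = (word_point X T q u, length u)" for u
  fix \<Gamma> assume \<Gamma>: "\<Gamma> \<in> word_covers N (itinerary T q ` E)"
  \<comment> \<open>Words without a realizing point are dropped, since their
    \<open>word_point\<close> need not lie in \<open>X\<close>.\<close>
  define \<Gamma>' where "\<Gamma>' = {u\<in>\<Gamma>. \<exists>x. realizes X T q u x}"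
  have point: "realizes X T q u (word_point X T q u)" if "u \<in> \<Gamma>'" for u
    using that realizes_word_point by (auto simp: \<Gamma>'_def)
  have len: "N \<le> length u" if "u \<in> \<Gamma>'" for u
    using that \<Gamma> by (auto simp: \<Gamma>'_def word_covers_def)
  have "h ` \<Gamma>' \<in> bowen_covers X T E N d"
  proof -
    have "y \<in> (\<Union>(x, n)\<in>h ` \<Gamma>'. bowen_ball X T n x d)" if "y \<in> E" for y
    proof -
      have "covers_words \<Gamma> (itinerary T q ` E)" using \<Gamma> by (simp add: word_covers_def)
      then obtain n where n: "map (itinerary T q y) [0..<n] \<in> \<Gamma>"
        using \<open>y \<in> E\<close> unfolding covers_words_def by (meson imageI)
      let ?u = "map (itinerary T q y) [0..<n]"
      have ry: "realizes X T q ?u y" using that \<open>E \<subseteq> X\<close> by (auto intro: realizes_itinerary)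
      then have u: "?u \<in> \<Gamma>'" using n by (auto simp: \<Gamma>'_def)
      have "1 \<le> n" using len[OF u] \<open>1 \<le> N\<close> by simp
      moreover have "dist ((T ^^ i) (word_point X T q ?u)) ((T ^^ i) y) < d" if "i < n" for i
        by (rule realizes_dist_less[OF q T point[OF u] ry]) (use that in auto)
      ultimately have "y \<in> bowen_ball X T n (word_point X T q ?u) d"
        using ry by (simp add: bowen_ball_def bowen_dist_less_iff realizes_def)
      then show ?thesis using u by (intro UN_I[of "h ?u"]) (auto simp: h_def)
    qed
    moreover have "countable \<Gamma>'" using \<Gamma> by (auto simp: \<Gamma>'_def word_covers_def)
    ultimately show ?thesis
      using point len unfolding bowen_covers_def by (auto simp: h_def realizes_def)
  qed
  moreover have "infsum (ball_weight X T f (s + c) d) (h ` \<Gamma>') \<le> infsum ?w \<Gamma>"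
  proof -
    have "infsum (ball_weight X T f (s + c) d) (h ` \<Gamma>') \<le> infsum (\<lambda>u. ball_weight X T f (s + c) d (h u)) \<Gamma>'"
      by (rule infsum_ennreal_image_le)
    also have "\<dots> \<le> infsum ?w \<Gamma>'"
    proof (rule infsum_mono)
      fix u assume u: "u \<in> \<Gamma>'"
      let ?n = "length u"
      let ?p = "word_point X T q u"
      have "(SUP y\<in>bowen_ball X T ?n ?p d. birkhoff_sum T f ?n y) \<le> birkhoff_sum T f ?n ?p + c * real ?n"
        using point[OF u] len[OF u] \<open>1 \<le> N\<close> \<open>0 < d\<close> osc T
        by (intro SUP_bowen_ball_le) (auto simp: realizes_def)
      then show "ball_weight X T f (s + c) d (h u) \<le> ?w u"
        unfolding ball_weight_def word_weight_def h_def
        by (auto intro!: ennreal_leI simp: algebra_simps)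
    qed auto
    also have "\<dots> \<le> infsum ?w \<Gamma>"
      by (rule infsum_ennreal_mono_set) (auto simp: \<Gamma>'_def)
    finally show ?thesis .
  qed
  ultimately show "\<exists>\<Delta>\<in>bowen_covers X T E N d. infsum (ball_weight X T f (s + c) d) \<Delta> \<le> infsum ?w \<Gamma>"
    by blast
qed

text \<open>A point is labelled by its cell. The bound on diameters gives the first property; a
  Lebesgue number of the cover by open cells gives \<open>e\<close>.\<close>

lemma zero_dimensional_coding:
  fixes X :: "'a::metric_space set"
  assumes "compact X" "zero_dimensional X" "0 < d"
  obtains q :: "'a \<Rightarrow> 'a set" and e where "0 < e"
    "\<And>x y. x \<in> X \<Longrightarrow> y \<in> X \<Longrightarrow> q x = q y \<Longrightarrow> dist x y < d"
    "\<And>x y. x \<in> X \<Longrightarrow> y \<in> X \<Longrightarrow> dist x y < e \<Longrightarrow> q x = q y"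
proof -
  obtain P where P: "\<Union>P = X" "\<And>A B. A \<in> P \<Longrightarrow> B \<in> P \<Longrightarrow> A \<noteq> B \<Longrightarrow> A \<inter> B = {}"
    "\<And>A. A \<in> P \<Longrightarrow> openin (top_of_set X) A" "\<And>A. A \<in> P \<Longrightarrow> diameter A < d"
    using assms(2,3) unfolding zero_dimensional_def by (auto; metis)
  define q where "q x = (THE A. A \<in> P \<and> x \<in> A)" for x
  have q_eq: "q x = A" if "A \<in> P" "x \<in> A" for x A
    unfolding q_def using that P(2) by (intro the_equality) blast+
  have q_in: "q x \<in> P \<and> x \<in> q x" if "x \<in> X" for x
    using that P(1) q_eq by (metis UnionE)
  have "dist x y < d" if "x \<in> X" "y \<in> X" "q x = q y" for x y
  proof -
    \<comment> \<open>\<open>diameter\<close> is sure to bound distances only on a bounded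
      set.\<close>
    have "bounded (q x)"
      using P(1) q_in[OF that(1)] assms(1) by (meson Union_upper bounded_subset compact_imp_bounded)
    then have "dist x y \<le> diameter (q x)"
      using q_in[OF that(1)] q_in[OF that(2)] that(3) by (intro diameter_bounded_bound) auto
    also have "\<dots> < d" using P(4) q_in[OF that(1)] by blast
    finally show ?thesis .
  qed
  \<comment> \<open>The cells are open only relative to \<open>X\<close>, so they are replaced by
    open sets of the ambient space that cut them out.\<close>
  moreover define \<G> where "\<G> = {G. open G \<and> X \<inter> G \<in> P}"
  have "X \<subseteq> \<Union>\<G>"
  proof
    fix x assume "x \<in> X"
    then obtain G where "open G" "q x = X \<inter> G" using q_in P(3) by (meson openin_open)
    then show "x \<in> \<Union>\<G>" using q_in[OF \<open>x \<in> X\<close>] by (auto simp: \<G>_def)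
  qed
  then obtain e where e: "0 < e" "\<And>x. x \<in> X \<Longrightarrow> \<exists>G\<in>\<G>. ball x e \<subseteq> G"
    by (rule Heine_Borel_lemma[OF assms(1)]) (auto simp: \<G>_def)
  have "q x = q y" if "x \<in> X" "y \<in> X" "dist x y < e" for x y
  proof -
    obtain G where G: "X \<inter> G \<in> P" "ball x e \<subseteq> G" 
      using e(2)[OF \<open>x \<in> X\<close>] by (auto simp: \<G>_def)
    then have "x \<in> X \<inter> G" "y \<in> X \<inter> G" using that e(1) by (auto simp: subset_iff)
    then show ?thesis using q_eq[OF G(1)] by simp
  qed
  ultimately show ?thesis using that e(1) by blast
qed

lemma continuous_on_funpow:
  assumes "continuous_on X T" "T ` X \<subseteq> X"
  shows "continuous_on X (T ^^ i)"
proof (induction i)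
  case (Suc i)
  have "(T ^^ i) ` X \<subseteq> X" using funpow_in[OF assms(2)] by blast
  then show ?case
    using Suc.IH assms(1) by (auto intro!: continuous_on_compose2[of X T] simp: o_def)
qed (simp add: continuous_on_id)

text \<open>The label is constant at distances below \<open>e\<close> and the orbit point depends
  continuously on \<open>z\<close>, so each symbol is locally constant in \<open>z\<close>.\<close>

lemma open_itinerary_level:
  fixes g :: "'c::topological_space \<Rightarrow> 'a::metric_space"
  assumes T: "continuous_on X T" "T ` X \<subseteq> X" and g: "continuous_on UNIV g" "range g \<subseteq> X"
    and "0 < e" and q: "\<And>x y. x \<in> X \<Longrightarrow> y \<in> X \<Longrightarrow> dist x y < e \<Longrightarrow> q x = q y"
  shows "open {z. itinerary T q (g z) i = a}"
proof (subst open_subopen, rule ballI)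
  fix z assume z: "z \<in> {z. itinerary T q (g z) i = a}"
  have "continuous_on UNIV (\<lambda>z. (T ^^ i) (g z))"
    using continuous_on_funpow[OF T] g by (rule continuous_on_compose2)
  moreover define V where "V = {y. (T ^^ i) (g y) \<in> ball ((T ^^ i) (g z)) e}"
  ultimately have "open V"
    using open_vimage[of "ball ((T ^^ i) (g z)) e" "\<lambda>z. (T ^^ i) (g z)"] by (simp add: vimage_def)
  moreover have "z \<in> V" using \<open>0 < e\<close> by (simp add: V_def)
  moreover have "V \<subseteq> {z. itinerary T q (g z) i = a}"
  proof
    fix y assume "y \<in> V"
    moreover have "(T ^^ i) (g y) \<in> X" "(T ^^ i) (g z) \<in> X"
      using g(2) funpow_in[OF T(2)] by auto
    ultimately have "q ((T ^^ i) (g z)) = q ((T ^^ i) (g y))"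
      by (intro q) (simp_all add: V_def)
    then show "y \<in> {z. itinerary T q (g z) i = a}" using z by (simp add: itinerary_def)
  qed
  ultimately show "\<exists>V. open V \<and> z \<in> V \<and> V \<subseteq> {z. itinerary T q (g z) i = a}" by blast
qed

text \<open>Positivity of \<open>bowen_M\<close> for \<open>Z\<close> is carried to words, there to
  the image of a compact box, and back to balls. Each of the two translations lowers the exponent by
  \<open>c\<close>.\<close>

lemma exists_compact_pressure_ge:
  fixes X :: "'a::metric_space set"
  assumes X: "compact X" and T: "continuous_on X T" "T ` X \<subseteq> X" and "zero_dimensional X"
    and f: "continuous_on X f" and "analytic_set Z" "Z \<subseteq> X"
    and s: "ereal s < bowen_pressure X T f Z"
  shows "\<exists>K. K \<subseteq> Z \<and> compact K \<and> ereal s \<le> bowen_pressure X T f K"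
proof -
  obtain g :: "(nat \<Rightarrow> nat) \<Rightarrow> 'a" where g: "continuous_on UNIV g" "range g = Z"
    using \<open>analytic_set Z\<close> unfolding analytic_set_def by blast
  obtain r where "ereal s < ereal r" and r: "ereal r < bowen_pressure X T f Z"
    using ereal_dense2[OF s] by blast
  \<comment> \<open>Half of the gap between \<open>s\<close> and \<open>r\<close>, one half for each
    translation.\<close>
  define c where "c = (r - s) / 2"
  have c: "0 < c" "s = r - c - c" using \<open>ereal s < ereal r\<close> by (auto simp: c_def field_simps)
  obtain d0 where d0: "0 < d0" "osc_le X f d0 c" using ex_osc_le[OF X f c(1)] by blast
  have "\<forall>\<^sub>F e in at_right 0. ereal r < bowen_pressure_eps X T f Z e"
    using bowen_pressure_tendsto[OF X T(2) f] r by (rule order_tendstoD)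
  moreover have "\<forall>\<^sub>F e in at_right 0. e \<in> {0<..<d0}"
    using d0(1) by (rule eventually_at_right_real)
  ultimately have "\<forall>\<^sub>F e in at_right 0. ereal r < bowen_pressure_eps X T f Z e \<and> e \<in> {0<..<d0}"
    by eventually_elim simp
  then obtain d where rd: "ereal r < bowen_pressure_eps X T f Z d" and d: "0 < d" "d < d0"
    using eventually_happens[of _ "at_right (0::real)"] by auto
  have osc: "osc_le X f d c" using osc_le_mono[OF d0(2)] d(2) by simp
  obtain N where N: "1 \<le> N" "0 < bowen_M X T f Z r N d"
    using bowen_M_pos_of_less_pressure_eps[OF rd] by blast
  obtain q :: "'a \<Rightarrow> 'a set" and e where e: "0 < e"
    and q: "\<And>x y. x \<in> X \<Longrightarrow> y \<in> X \<Longrightarrow> q x = q y \<Longrightarrow> dist x y < d"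
      "\<And>x y. x \<in> X \<Longrightarrow> y \<in> X \<Longrightarrow> dist x y < e \<Longrightarrow> q x = q y"
    using zero_dimensional_coding[OF X \<open>zero_dimensional X\<close> d(1)] by metis
  let ?w = "word_weight X T f q (r - c)"
  have "bowen_M X T f Z ((r - c) + c) N d \<le> word_measure ?w N (itinerary T q ` Z)"
    using q(1) osc T(2) d(1) \<open>Z \<subseteq> X\<close> N(1) by (rule bowen_M_le_word_measure)
  moreover have "itinerary T q ` Z = range (\<lambda>z. itinerary T q (g z))" using g(2) by auto
  ultimately have "0 < word_measure ?w N (range (\<lambda>z. itinerary T q (g z)))"
    using N(2) by simp
  then obtain t where t: "0 < t" "t < word_measure ?w N (range (\<lambda>z. itinerary T q (g z)))"
    using dense by blast
  have "open {z. itinerary T q (g z) i = a}" for i a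
    by (rule open_itinerary_level[OF T g(1) _ e q(2)]) (use g(2) \<open>Z \<subseteq> X\<close> in auto)
  from word_measure_compact_inner[OF this t(2)] obtain L
    where L: "compact L" "t \<le> word_measure ?w N ((\<lambda>z. itinerary T q (g z)) ` L)" by blast
  define K where "K = g ` L"
  have "compact K"
    unfolding K_def using L(1) continuous_on_subset[OF g(1)] by (intro compact_continuous_image) auto
  have "K \<subseteq> Z" using g(2) by (auto simp: K_def)
  have pos: "0 < word_measure ?w N (itinerary T q ` K)"
    using t(1) L(2) by (simp add: K_def image_image)
  \<comment> \<open>The same \<open>K\<close>, \<open>N\<close> and \<open>s\<close> serve every
    scale below \<open>min d e\<close>, so the bound survives the limit of small scales.\<close>
  have "\<forall>\<^sub>F e' in at_right 0. e' \<in> {0<..<min d e}"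
    using d(1) e by (intro eventually_at_right_real) simp
  then have "\<forall>\<^sub>F e' in at_right 0. ereal s \<le> bowen_pressure_eps X T f K e'"
  proof eventually_elim
    case (elim e')
    have "word_measure (word_weight X T f q (s + c)) N (itinerary T q ` K) \<le> bowen_M X T f K s N e'"
    proof (rule word_measure_le_bowen_M[OF q(1) _ osc T(2) _ _ _ N(1)])
      show "q x = q y" if "x \<in> X" "y \<in> X" "dist x y < e'" for x y
        using that elim by (intro q(2)) auto
      show "0 < e'" "e' \<le> d" using elim by auto
      show "K \<subseteq> X" using \<open>K \<subseteq> Z\<close> \<open>Z \<subseteq> X\<close> by (rule order_trans)
    qed
    moreover have "s + c = r - c" using c(2) by simp
    ultimately have "0 < bowen_M X T f K s N e'" using pos by simp
    then show ?case using N(1) by (rule bowen_pressure_eps_geI)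
  qed
  then have "ereal s \<le> bowen_pressure X T f K"
    using bowen_pressure_tendsto[OF X T(2) f] by (intro tendsto_lowerbound) auto
  then show ?thesis using \<open>compact K\<close> \<open>K \<subseteq> Z\<close> by blast
qed

theorem theorem3p5:
  fixes X :: "'a::metric_space set" and T :: "'a \<Rightarrow> 'a" and f :: "'a \<Rightarrow> real"
    and Z :: "'a set"
  assumes "compact X"
    and "continuous_on X T" and "T ` X \<subseteq> X"
    and "zero_dimensional X"
    and "continuous_on X f"
    and "analytic_set Z" and "Z \<subseteq> X"
  shows "bowen_pressure X T f Z = (SUP K\<in>{K. K \<subseteq> Z \<and> compact K}. bowen_pressure X T f K)"
proof (rule antisym)
  show "bowen_pressure X T f Z \<le> (SUP K\<in>{K. K \<subseteq> Z \<and> compact K}. bowen_pressure X T f K)"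
  proof (rule ccontr)
    assume "\<not> ?thesis"
    \<comment> \<open>The compact set depends on a real \<open>s\<close> below the pressure of
      \<open>Z\<close>, so such an \<open>s\<close> is placed strictly between the two
      sides.\<close>
    then obtain s where s: "(SUP K\<in>{K. K \<subseteq> Z \<and> compact K}. bowen_pressure X T f K) < ereal s"
      and "ereal s < bowen_pressure X T f Z"
      using ereal_dense2 by (meson not_le)
    then obtain K where "K \<subseteq> Z" "compact K" "ereal s \<le> bowen_pressure X T f K"
      using exists_compact_pressure_ge[OF assms] by blast
    then have "ereal s \<le> (SUP K\<in>{K. K \<subseteq> Z \<and> compact K}. bowen_pressure X T f K)"
      by (intro SUP_upper2) auto
    with s show False by simp
  qed
  show "(SUP K\<in>{K. K \<subseteq> Z \<and> compact K}. bowen_pressure X T f K) \<le> bowen_pressure X T f Z"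
  proof (rule SUP_least)
    fix K assume "K \<in> {K. K \<subseteq> Z \<and> compact K}"
    then have "\<forall>\<^sub>F e in at_right 0. bowen_pressure_eps X T f K e \<le> bowen_pressure_eps X T f Z e"
      by (intro always_eventually allI bowen_pressure_eps_mono) auto
    then show "bowen_pressure X T f K \<le> bowen_pressure X T f Z"
      by (rule tendsto_le[OF trivial_limit_at_right_real
            bowen_pressure_tendsto[OF assms(1,3,5)] bowen_pressure_tendsto[OF assms(1,3,5)]])
  qed
qed

end
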